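(* Let $A=I-A_1\in\mathcal{QT}_\infty$ with $A_1\ge 0$ and $\|A_1\|_\infty<1$, and let $B=T(b)+E_B\in\mathcal{QT}_\infty$ be the unique matrix in $\mathcal{QT}_\infty$ with $B\ge0$, $\|B\|_\infty<1$ and $(I-B)^2=A$, where $T(b)$ is the Toeplitz part and $E_B$ the correction part of $B$. Let $\epsilon>0$ and let $k$ be a positive integer such that $\|E_B^{(k)}-E_B\|_\infty<\epsilon$, where $E_B^{(k)}$ is the infinite matrix that coincides with $E_B$ in the leading principal $k\times k$ submatrix and is zero elsewhere. Partition $$T(b)=\begin{pmatrix} T_{11} & T_{12} \\ T_{21} & T_{22} \end{pmatrix},\qquad W:=2T(b)-A_1-T(b)^2=\begin{pmatrix} W_{11} & W_{12} \\ W_{21} & W_{22} \end{pmatrix},$$ with $T_{11},W_{11}$ of size $k\times k$, and let $E_{11}$ and $A_{11}$ be the leading principal $k\times k$ submatrices of $E_B$ and $A_1$. Assume $\|A_{11}+T_{12}T_{21}\|_\infty<1$, and let $G$ be the unique $k\times k$ solution of $$G^2-(I_k-T_{11})G-G(I_k-T_{11})=W_{11}$$ such that $T_{11}+G\ge 0$ and $\rho(T_{11}+G)<1$. Let $E_G$ be the infinite matrix whose leading principal $k\times k$ submatrix is $G$ and which is zero elsewhere, and put $\alpha=\|(2I_k-T_{11}-G)^{-1}\|_\infty$, $\beta=\|T_{11}+E_{11}\|_\infty$. Then $\alpha\beta<1$ and $$\|E_G-E_B\|_\infty\le\Bigl(1+\frac{\alpha}{1-\alpha\beta}\bigl(2\|b\|_{\mathcal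 W}+\epsilon\bigr)\Bigr)\epsilon .$$
   Context: The Wiener algebra is $\mathcal W=\{a(z)=\sum_{i\in\mathbb Z}a_iz^i : |z|=1,\ \|a\|_{\mathcal W}:=\sum_{i\in\mathbb Z}|a_i|<\infty\}$. For $a\in\mathcal W$, $T(a)$ is the semi-infinite Toeplitz matrix with entries $(T(a))_{i,j}=a_{j-i}$, $i,j\in\mathbb Z^+=\{1,2,\dots\}$. Let $\mathcal K_d(\ell^\infty)$ be the set of infinite matrices $E=(e_{i,j})_{i,j\in\mathbb Z^+}$ (representing bounded operators on $\ell^\infty$) with $\lim_{i\to\infty}\sum_{j=1}^\infty|e_{i,j}|=0$. The class of quasi-Toeplitz matrices is $\mathcal{QT}_\infty=\{T(a)+E : a\in\mathcal W,\ E\in\mathcal K_d(\ell^\infty)\}$; it is a Banach algebra of bounded operators on $\ell^\infty$ with the norm $\|A\|_\infty=\sup_i\sum_{j=1}^\infty|a_{i,j}|$ (the same notation, maximum absolute row sum, is used for finite and rectangular matrices). For $A=T(a)+E\in\mathcal{QT}_\infty$, $T(a)$ is the Toeplitz part and $E$ the correction part of $A$. $B\ge 0$ means that all entries are nonnegative; $I$ is the infinite identity matrix, $I_k$ the $k\times k$ identity; $\rho(\cdot)$ is the spectral radius. It is known that if $A_1\in\mathcal{QT}_\infty$, $A_1\ge0$, $\|A_1\|_\infty<1$, there is a unique $B\in\mathcal{QT}_\infty$ with $B\ge 0$, $\|B\|_\infty<1$ and $(I-B)^2=I-A_1$. The equation for $G$ is equivalent to $(I_k-T_{11}-G)^2=I_k-A_{11}-T_{12}T_{21}$;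 under the assumption $\|A_{11}+T_{12}T_{21}\|_\infty<1$ it has a unique solution $G$ with $T_{11}+G\ge0$ and $\rho(T_{11}+G)<1$ (the $M$-matrix square root of the nonsingular $M$-matrix $I_k-A_{11}-T_{12}T_{21}$). *)

theory Defs
  imports
    "HOL-Analysis.Infinite_Sum"
    "HOL-Library.Nonpos_Ints"
    "Jordan_Normal_Form.Gauss_Jordan_Elimination"
    "Jordan_Normal_Form.Spectral_Radius"
begin

text \<open>Rows and columns of infinite matrices are numbered from 0 rather than from 1. A Toeplitz
  entry depends only on the difference of the indices, so the shift is immaterial.\<close>

type_synonym imat = "nat \<Rightarrow> nat \<Rightarrow> complex"

text \<open>A function in the Wiener algebra is represented by the family of its Laurent coefficients,
  which determines it.\<close>

definition wiener :: "(int \<Rightarrow> complex) set" where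
  "wiener = {a. (\<lambda>i. cmod (a i)) summable_on UNIV}"

definition wiener_norm :: "(int \<Rightarrow> complex) \<Rightarrow> real" where
  "wiener_norm a = (\<Sum>\<^sub>\<infinity>i. cmod (a i))"

definition toeplitz :: "(int \<Rightarrow> complex) \<Rightarrow> imat" where
  "toeplitz a = (\<lambda>i j. a (int j - int i))"

definition imat_add :: "imat \<Rightarrow> imat \<Rightarrow> imat" (infixl \<open>+\<^sub>\<infinity>\<close> 65) where
  "A +\<^sub>\<infinity> B = (\<lambda>i j. A i j + B i j)"

definition imat_minus :: "imat \<Rightarrow> imat \<Rightarrow> imat" (infixl \<open>-\<^sub>\<infinity>\<close> 65) where
  "A -\<^sub>\<infinity> B = (\<lambda>i j. A i j - B i j)"

definition imat_smult :: "complex \<Rightarrow> imat \<Rightarrow> imat" (infixl \<open>\<cdot>\<^sub>\<infinity>\<close> 70) where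
  "c \<cdot>\<^sub>\<infinity> A = (\<lambda>i j. c * A i j)"

definition imat_mult :: "imat \<Rightarrow> imat \<Rightarrow> imat" (infixl \<open>*\<^sub>\<infinity>\<close> 70) where
  "A *\<^sub>\<infinity> B = (\<lambda>i j. \<Sum>\<^sub>\<infinity>l. A i l * B l j)"

definition imat_one :: imat (\<open>1\<^sub>\<infinity>\<close>) where
  "1\<^sub>\<infinity> = (\<lambda>i j. if i = j then 1 else 0)"

definition imat_nonneg :: "imat \<Rightarrow> bool" where
  "imat_nonneg A \<longleftrightarrow> (\<forall>i j. A i j \<in> \<real>\<^sub>\<ge>\<^sub>0)"

text \<open>The norm is a genuine supremum of genuine row sums exactly for the matrices that represent
  a bounded operator; see \<open>bounded_linf_op_iff\<close> below.\<close>

definition imat_norm :: "imat \<Rightarrow> real" where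
  "imat_norm A = (SUP i. \<Sum>\<^sub>\<infinity>j. cmod (A i j))"

definition bounded_linf_op :: "imat \<Rightarrow> bool" where
  "bounded_linf_op A \<longleftrightarrow>
    (\<exists>C. \<forall>x :: nat \<Rightarrow> complex. \<forall>M. (\<forall>j. cmod (x j) \<le> M) \<longrightarrow>
      (\<forall>i. (\<lambda>j. A i j * x j) summable_on UNIV \<and> cmod (\<Sum>\<^sub>\<infinity>j. A i j * x j) \<le> C * M))"

definition Kd :: "imat set" where
  "Kd = {E. bounded_linf_op E \<and> (\<lambda>i. \<Sum>\<^sub>\<infinity>j. cmod (E i j)) \<longlonglongrightarrow> 0}"

definition QT :: "imat set" where
  "QT = {toeplitz a +\<^sub>\<infinity> E | a E. a \<in> wiener \<and> E \<in> Kd}"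

definition lead :: "nat \<Rightarrow> imat \<Rightarrow> complex mat" where
  "lead k A = mat k k (\<lambda>(i, j). A i j)"

definition pad :: "complex mat \<Rightarrow> imat" where
  "pad M = (\<lambda>i j. if i < dim_row M \<and> j < dim_col M then M $$ (i, j) else 0)"

text \<open>The off-diagonal blocks of the partition with a leading \<open>k \<times> k\<close> block. Only the
  first \<open>k\<close> rows of \<open>block12 k A\<close> and the first \<open>k\<close> columns of
  \<open>block21 k A\<close> belong to the block, hence the product of a block \<open>12\<close> with a block
  \<open>21\<close> is \<open>lead k (block12 k A *\<^sub>\<infinity> block21 k A)\<close>.\<close>

definition block12 :: "nat \<Rightarrow> imat \<Rightarrow> imat" where
  "block12 k A = (\<lambda>i j. A i (j + k))"

definition block21 :: "nat \<Rightarrow> imat \<Rightarrow> imat" where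
  "block21 k A = (\<lambda>i j. A (i + k) j)"

definition mat_nonneg :: "complex mat \<Rightarrow> bool" where
  "mat_nonneg M \<longleftrightarrow> (\<forall>i < dim_row M. \<forall>j < dim_col M. M $$ (i, j) \<in> \<real>\<^sub>\<ge>\<^sub>0)"

definition mat_norm :: "complex mat \<Rightarrow> real" where
  "mat_norm M = Max ((\<lambda>i. \<Sum>j < dim_col M. cmod (M $$ (i, j))) ` {..<dim_row M})"

lemma bounded_linf_op_iff:
  "bounded_linf_op A \<longleftrightarrow>
    (\<forall>i. (\<lambda>j. cmod (A i j)) summable_on UNIV) \<and>
    bdd_above (range (\<lambda>i. \<Sum>\<^sub>\<infinity>j. cmod (A i j)))"
proof
  assume "bounded_linf_op A"
  then obtain C where C: "\<And>x M i. (\<And>j. cmod (x j) \<le> M) \<Longrightarrow>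
      (\<lambda>j. A i j * x j) summable_on UNIV \<and> cmod (\<Sum>\<^sub>\<infinity>j. A i j * x j) \<le> C * M"
    unfolding bounded_linf_op_def by metis
  have s: "(\<lambda>j. cmod (A i j)) summable_on UNIV" for i
    using C[of "\<lambda>_. 1" 1 i] by (simp add: summable_on_iff_abs_summable_on_complex)
  have "(\<Sum>\<^sub>\<infinity>j. cmod (A i j)) \<le> C" for i
  proof -
    have "A i j * cnj (sgn (A i j)) = of_real (cmod (A i j))" for j
      by (cases "A i j = 0") (simp_all add: sgn_eq complex_norm_square[symmetric] power2_eq_square)
    moreover have "cmod (cnj (sgn (A i j))) \<le> 1" for j
      by (simp add: norm_sgn)
    ultimately have "cmod (\<Sum>\<^sub>\<infinity>j. complex_of_real (cmod (A i j))) \<le> C"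
      using C[of "\<lambda>j. cnj (sgn (A i j))" 1 i] by simp
    moreover have "(\<Sum>\<^sub>\<infinity>j. complex_of_real (cmod (A i j))) = of_real (\<Sum>\<^sub>\<infinity>j. cmod (A i j))"
      using s has_sum_of_real_iff has_sum_infsum infsumI by blast
    ultimately show ?thesis by (simp add: norm_of_real)
  qed
  with s show "(\<forall>i. (\<lambda>j. cmod (A i j)) summable_on UNIV) \<and>
    bdd_above (range (\<lambda>i. \<Sum>\<^sub>\<infinity>j. cmod (A i j)))"
    by (auto intro!: bdd_aboveI)
next
  assume *: "(\<forall>i. (\<lambda>j. cmod (A i j)) summable_on UNIV) \<and>
    bdd_above (range (\<lambda>i. \<Sum>\<^sub>\<infinity>j. cmod (A i j)))"
  then obtain C where C: "\<And>i. (\<Sum>\<^sub>\<infinity>j. cmod (A i j)) \<le> C"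
    unfolding bdd_above_def by auto
  have "(\<lambda>j. A i j * x j) summable_on UNIV \<and> cmod (\<Sum>\<^sub>\<infinity>j. A i j * x j) \<le> C * M"
    if M: "\<forall>j. cmod (x j) \<le> M" for x M i
  proof -
    have M0: "0 \<le> M" using M norm_ge_zero order_trans by blast
    have s: "(\<lambda>j. cmod (A i j) * M) summable_on UNIV"
      using * by (intro summable_on_cmult_left) blast
    have le: "cmod (A i j * x j) \<le> cmod (A i j) * M" for j
      using M by (simp add: norm_mult mult_left_mono)
    have abs: "(\<lambda>j. A i j * x j) abs_summable_on UNIV"
      by (rule abs_summable_on_comparison_test'[OF s]) (use le in simp)
    have "cmod (\<Sum>\<^sub>\<infinity>j. A i j * x j) \<le> (\<Sum>\<^sub>\<infinity>j. cmod (A i j * x j))"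
      by (rule norm_infsum_bound[OF abs])
    also have "\<dots> \<le> (\<Sum>\<^sub>\<infinity>j. cmod (A i j) * M)"
      by (rule infsum_mono[OF abs s le])
    also have "\<dots> = (\<Sum>\<^sub>\<infinity>j. cmod (A i j)) * M"
      using * by (intro infsum_cmult_left) blast
    also have "\<dots> \<le> C * M" using C M0 by (rule mult_right_mono)
    finally show ?thesis using abs_summable_summable[OF abs] by simp
  qed
  then show "bounded_linf_op A" unfolding bounded_linf_op_def by blast
qed

text \<open>The inverse of \<open>2 I - T\<^sub>1\<^sub>1 - G\<close> exists because the spectral radius of
  \<open>T\<^sub>1\<^sub>1 + G\<close> is less than 1.\<close>

lemma mat_inverse_two_minus:
  fixes T G :: "complex mat"
  assumes T: "T \<in> carrier_mat k k" and G: "G \<in> carrier_mat k k" and k: "0 < k"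
    and rho: "spectral_radius (T + G) < 1"
  shows "\<exists>N \<in> carrier_mat k k. mat_inverse (2 \<cdot>\<^sub>m 1\<^sub>m k - T - G) = Some N \<and>
    (2 \<cdot>\<^sub>m 1\<^sub>m k - T - G) * N = 1\<^sub>m k \<and> N * (2 \<cdot>\<^sub>m 1\<^sub>m k - T - G) = 1\<^sub>m k"
proof -
  let ?M = "2 \<cdot>\<^sub>m 1\<^sub>m k - T - G"
  have M: "?M \<in> carrier_mat k k" using T G by auto
  have TG: "T + G \<in> carrier_mat k k" using T G by auto
  have "det ?M \<noteq> 0"
  proof
    assume "det ?M = 0"
    moreover have "char_matrix (T + G) 2 = (- 1) \<cdot>\<^sub>m ?M"
      using T G by (intro eq_matI) (auto simp: char_matrix_def)
    ultimately have "det (char_matrix (T + G) 2) = 0"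
      by (simp add: det_smult)
    then have "2 \<in> spectrum (T + G)"
      unfolding spectrum_def using eigenvalue_det[OF TG] by simp
    then have "2 \<le> spectral_radius (T + G)"
      using spectral_radius_mem_max(2)[OF TG k, of 2] by (metis image_eqI norm_numeral)
    with rho show False by simp
  qed
  then have "?M \<in> Units (ring_mat TYPE(complex) k ())"
    by (rule det_non_zero_imp_unit[OF M])
  then obtain N where "mat_inverse ?M = Some N"
    using mat_inverse(1)[OF M, where b = "()"] by (cases "mat_inverse ?M") auto
  with mat_inverse(2)[OF M this] show ?thesis by blast
qed

end

theory Submission
  imports Defs
begin

text \<open>Put \<open>S = T\<^sub>1\<^sub>1 + G\<close>,
  \<open>P = T\<^sub>1\<^sub>2 T\<^sub>2\<^sub>1\<close> and
  \<open>Q = B\<^sub>1\<^sub>2 B\<^sub>2\<^sub>1\<close>. The equation for \<open>G\<close> says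
  \<open>2 S = A\<^sub>1\<^sub>1 + P + S\<^sup>2\<close>, and the leading block of
  \<open>2 B = A\<^sub>1 + B\<^sup>2\<close> says
  \<open>2 B\<^sub>1\<^sub>1 = A\<^sub>1\<^sub>1 + Q + B\<^sub>1\<^sub>1\<^sup>2\<close>.
  Subtracting, \<open>D = S - B\<^sub>1\<^sub>1 = G - E\<^sub>1\<^sub>1\<close> satisfies
  \<open>(2 I - S) D = D B\<^sub>1\<^sub>1 + (P - Q)\<close>, so
  \<open>\<parallel>D\<parallel> \<le> \<alpha> (\<beta> \<parallel>D\<parallel> + \<parallel>P - Q\<parallel>)\<close>, where
  \<open>P - Q\<close> is small because \<open>E\<^sub>1\<^sub>2\<close> and
  \<open>E\<^sub>2\<^sub>1\<close> have norm below \<open>\<epsilon>\<close>.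
  For \<open>\<alpha> \<beta> < 1\<close> it suffices that \<open>\<alpha> \<le> 1\<close>. This follows from
  \<open>S 1 \<le> 1\<close>: the vector \<open>v = (I - S) 1\<close> satisfies
  \<open>(I - S) v = 1 - (A\<^sub>1\<^sub>1 + P) 1 \<ge> 0\<close>, hence
  \<open>v \<ge> S\<^sup>n v \<rightarrow> 0\<close>.\<close>

subsection \<open>Infinite matrices with bounded row sums\<close>

lemma bounded_linf_op_summable:
  "bounded_linf_op A \<Longrightarrow> (\<lambda>j. cmod (A i j)) summable_on UNIV"
  by (simp add: bounded_linf_op_iff)

lemma imat_norm_upper:
  "bounded_linf_op A \<Longrightarrow> (\<Sum>\<^sub>\<infinity>j. cmod (A i j)) \<le> imat_norm A"
  unfolding imat_norm_def by (rule cSUP_upper) (auto simp: bounded_linf_op_iff)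

lemma imat_norm_least:
  "(\<And>i. (\<Sum>\<^sub>\<infinity>j. cmod (A i j)) \<le> C) \<Longrightarrow> imat_norm A \<le> C"
  unfolding imat_norm_def by (rule cSUP_least) auto

lemma bounded_linf_opI:
  assumes "\<And>i. (\<lambda>j. cmod (A i j)) summable_on UNIV"
    and "\<And>i. (\<Sum>\<^sub>\<infinity>j. cmod (A i j)) \<le> C"
  shows "bounded_linf_op A"
  unfolding bounded_linf_op_iff using assms by (auto intro!: bdd_aboveI)

section \<open>Sums of nonnegative families over subsets and injective images\<close>

lemma infsum_subset_le:
  fixes f :: "'a \<Rightarrow> real"
  assumes "f summable_on UNIV" and "\<And>x. 0 \<le> f x"
  shows "infsum f X \<le> infsum f UNIV"
  using assms by (intro infsum_mono2) (auto intro: summable_on_subset_banach)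

lemma sum_le_infsum_UNIV:
  fixes f :: "'a \<Rightarrow> real"
  assumes "f summable_on UNIV" and "\<And>x. 0 \<le> f x" and "finite X"
  shows "sum f X \<le> infsum f UNIV"
  using infsum_subset_le[of f X] assms by simp

lemma summable_on_inj_comp:
  fixes f :: "'a \<Rightarrow> real"
  assumes "f summable_on UNIV" and "inj h"
  shows "(\<lambda>x. f (h x)) summable_on UNIV"
  using assms summable_on_reindex[of h UNIV f] summable_on_subset_banach[of f UNIV "range h"]
  by (simp add: o_def)

lemma infsum_inj_comp_le:
  fixes f :: "'a \<Rightarrow> real"
  assumes "f summable_on UNIV" and "\<And>x. 0 \<le> f x" and "inj h"
  shows "(\<Sum>\<^sub>\<infinity>x. f (h x)) \<le> infsum f UNIV"
  using infsum_reindex[of h UNIV f] infsum_subset_le[of f "range h"] assms by (simp add: o_def)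

text \<open>Row \<open>i\<close> samples the coefficient family along an injective shift of the
  index, so absolute summability passes from \<open>a\<close> to every row.\<close>

lemma toeplitz_summable:
  assumes "a \<in> wiener"
  shows "(\<lambda>j. cmod (toeplitz a i j)) summable_on UNIV"
  using summable_on_inj_comp[of "\<lambda>d. cmod (a d)" "\<lambda>j. int j - int i"] assms
  by (simp add: wiener_def toeplitz_def inj_on_def)

lemma toeplitz_row_sum_le:
  assumes "a \<in> wiener"
  shows "(\<Sum>\<^sub>\<infinity>j. cmod (toeplitz a i j)) \<le> wiener_norm a"
  using infsum_inj_comp_le[of "\<lambda>d. cmod (a d)" "\<lambda>j. int j - int i"] assms
  by (simp add: wiener_def wiener_norm_def toeplitz_def inj_on_def)

lemma bounded_linf_op_toeplitz: "a \<in> wiener \<Longrightarrow> bounded_linf_op (toeplitz a)"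
  by (rule bounded_linf_opI[OF toeplitz_summable toeplitz_row_sum_le])

text \<open>The sum runs along a single row, over finitely many columns. It serves the rows of the
  block \<open>21\<close>, which are cut off after \<open>k\<close> columns.\<close>

lemma toeplitz_col_sum_le:
  assumes "a \<in> wiener" and "finite J"
  shows "(\<Sum>j\<in>J. cmod (toeplitz a i j)) \<le> wiener_norm a"
  using sum_le_infsum_UNIV[OF toeplitz_summable[OF assms(1)] _ assms(2)]
    toeplitz_row_sum_le[OF assms(1)] by (meson norm_ge_zero order_trans)

lemma summable_norm_add:
  fixes f g :: "'a \<Rightarrow> complex"
  assumes "(\<lambda>x. cmod (f x)) summable_on X" and "(\<lambda>x. cmod (g x)) summable_on X"
  shows "(\<lambda>x. cmod (f x + g x)) summable_on X"
  by (rule abs_summable_on_comparison_test'[OF summable_on_add[OF assms]]) (rule norm_triangle_ineq)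

lemma infsum_norm_add_le:
  fixes f g :: "'a \<Rightarrow> complex"
  assumes "(\<lambda>x. cmod (f x)) summable_on X" and "(\<lambda>x. cmod (g x)) summable_on X"
  shows "(\<Sum>\<^sub>\<infinity>x\<in>X. cmod (f x + g x)) \<le> (\<Sum>\<^sub>\<infinity>x\<in>X. cmod (f x)) + (\<Sum>\<^sub>\<infinity>x\<in>X. cmod (g x))"
  using infsum_mono[OF summable_norm_add[OF assms] summable_on_add[OF assms] norm_triangle_ineq]
  by (simp add: infsum_add assms)

lemma imat_add_row_sum_le:
  assumes "bounded_linf_op A" and "bounded_linf_op B"
  shows "(\<Sum>\<^sub>\<infinity>j. cmod ((A +\<^sub>\<infinity> B) i j)) \<le> imat_norm A + imat_norm B"
  unfolding imat_add_def
  using infsum_norm_add_le[OF bounded_linf_op_summable[OF assms(1)]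
      bounded_linf_op_summable[OF assms(2)], of i i]
    imat_norm_upper[OF assms(1), of i] imat_norm_upper[OF assms(2), of i]
  by linarith

lemma bounded_linf_op_add:
  assumes "bounded_linf_op A" and "bounded_linf_op B"
  shows "bounded_linf_op (A +\<^sub>\<infinity> B)"
proof (rule bounded_linf_opI[OF _ imat_add_row_sum_le[OF assms]])
  show "(\<lambda>j. cmod ((A +\<^sub>\<infinity> B) i j)) summable_on UNIV" for i
    unfolding imat_add_def by (intro summable_norm_add bounded_linf_op_summable assms)
qed

lemma imat_norm_add_le:
  assumes "bounded_linf_op A" and "bounded_linf_op B"
  shows "imat_norm (A +\<^sub>\<infinity> B) \<le> imat_norm A + imat_norm B"
  by (rule imat_norm_least[OF imat_add_row_sum_le[OF assms]])

lemma bounded_linf_op_minus: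
  assumes "bounded_linf_op A" and "bounded_linf_op B"
  shows "bounded_linf_op (A -\<^sub>\<infinity> B)"
proof -
  have "bounded_linf_op (\<lambda>i j. - B i j)"
    using assms(2) by (simp add: bounded_linf_op_iff)
  from bounded_linf_op_add[OF assms(1) this] show ?thesis
    by (simp add: imat_add_def imat_minus_def)
qed

lemma summable_imat_one: "(\<lambda>j. cmod (1\<^sub>\<infinity> i j)) summable_on UNIV"
  and infsum_imat_one: "(\<Sum>\<^sub>\<infinity>j. cmod (1\<^sub>\<infinity> i j)) = 1"
proof -
  have "(\<lambda>j. cmod (1\<^sub>\<infinity> i j)) summable_on UNIV \<longleftrightarrow> (\<lambda>_. 1::real) summable_on {i}"
    by (rule summable_on_cong_neutral) (auto simp: imat_one_def)
  then show "(\<lambda>j. cmod (1\<^sub>\<infinity> i j)) summable_on UNIV" by simp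
  have "(\<Sum>\<^sub>\<infinity>j. cmod (1\<^sub>\<infinity> i j)) = (\<Sum>\<^sub>\<infinity>j\<in>{i}. 1)"
    by (rule infsum_cong_neutral) (auto simp: imat_one_def)
  then show "(\<Sum>\<^sub>\<infinity>j. cmod (1\<^sub>\<infinity> i j)) = 1" by simp
qed

lemma bounded_linf_op_one: "bounded_linf_op 1\<^sub>\<infinity>"
  by (rule bounded_linf_opI[OF summable_imat_one]) (rule eq_refl[OF infsum_imat_one])

section \<open>Unit and distributive laws of the infinite matrix product\<close>

lemma imat_one_mult: "1\<^sub>\<infinity> *\<^sub>\<infinity> A = A"
proof (intro ext)
  fix i j
  have "(1\<^sub>\<infinity> *\<^sub>\<infinity> A) i j = (\<Sum>\<^sub>\<infinity>l\<in>{i}. A l j)"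
    unfolding imat_mult_def by (rule infsum_cong_neutral) (auto simp: imat_one_def)
  then show "(1\<^sub>\<infinity> *\<^sub>\<infinity> A) i j = A i j" by simp
qed

lemma imat_mult_one: "A *\<^sub>\<infinity> 1\<^sub>\<infinity> = A"
proof (intro ext)
  fix i j
  have "(A *\<^sub>\<infinity> 1\<^sub>\<infinity>) i j = (\<Sum>\<^sub>\<infinity>l\<in>{j}. A i l)"
    unfolding imat_mult_def by (rule infsum_cong_neutral) (auto simp: imat_one_def)
  then show "(A *\<^sub>\<infinity> 1\<^sub>\<infinity>) i j = A i j" by simp
qed

lemma cmod_le_imat_norm: "bounded_linf_op A \<Longrightarrow> cmod (A i j) \<le> imat_norm A"
  using sum_le_infsum_UNIV[OF bounded_linf_op_summable, of A i "{j}"] imat_norm_upper[of A i]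
  by fastforce

text \<open>The row of \<open>A\<close> is absolutely summable and the entries of \<open>B\<close>
  are bounded by its norm. This justifies splitting the infinite sums in the distributive
  laws.\<close>

lemma imat_mult_abs_summable:
  assumes A: "bounded_linf_op A" and B: "bounded_linf_op B"
  shows "(\<lambda>l. cmod (A i l * B l j)) summable_on UNIV"
  by (rule abs_summable_on_comparison_test'[OF
        summable_on_cmult_left[OF bounded_linf_op_summable[OF A], where c = "imat_norm B"]])
    (auto simp: norm_mult intro!: mult_left_mono cmod_le_imat_norm[OF B])

lemma imat_mult_summable:
  assumes "bounded_linf_op A" and "bounded_linf_op B"
  shows "(\<lambda>l. A i l * B l j) summable_on UNIV"
  by (rule abs_summable_summable[OF imat_mult_abs_summable[OF assms]])

lemma infsum_minus_distrib:
  fixes f g :: "'a \<Rightarrow> complex"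
  assumes "f summable_on X" and "g summable_on X"
  shows "(\<Sum>\<^sub>\<infinity>x\<in>X. f x - g x) = infsum f X - infsum g X"
  using infsum_add[OF assms(1), of "\<lambda>x. - g x"] assms(2)
  by (simp add: infsum_uminus summable_on_uminus)

lemma imat_add_mult_distrib:
  assumes "bounded_linf_op A" and "bounded_linf_op B" and "bounded_linf_op C"
  shows "(A +\<^sub>\<infinity> B) *\<^sub>\<infinity> C = A *\<^sub>\<infinity> C +\<^sub>\<infinity> B *\<^sub>\<infinity> C"
  by (simp add: fun_eq_iff imat_mult_def imat_add_def distrib_right
      infsum_add imat_mult_summable assms)

lemma imat_mult_add_distrib:
  assumes "bounded_linf_op A" and "bounded_linf_op B" and "bounded_linf_op C"
  shows "C *\<^sub>\<infinity> (A +\<^sub>\<infinity> B) = C *\<^sub>\<infinity> A +\<^sub>\<infinity> C *\<^sub>\<infinity> B"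
  by (simp add: fun_eq_iff imat_mult_def imat_add_def distrib_left
      infsum_add imat_mult_summable assms)

lemma imat_minus_mult_distrib:
  assumes "bounded_linf_op A" and "bounded_linf_op B" and "bounded_linf_op C"
  shows "(A -\<^sub>\<infinity> B) *\<^sub>\<infinity> C = A *\<^sub>\<infinity> C -\<^sub>\<infinity> B *\<^sub>\<infinity> C"
  by (simp add: fun_eq_iff imat_mult_def imat_minus_def left_diff_distrib
      infsum_minus_distrib imat_mult_summable assms)

lemma imat_mult_minus_distrib:
  assumes "bounded_linf_op A" and "bounded_linf_op B" and "bounded_linf_op C"
  shows "C *\<^sub>\<infinity> (A -\<^sub>\<infinity> B) = C *\<^sub>\<infinity> A -\<^sub>\<infinity> C *\<^sub>\<infinity> B"
  by (simp add: fun_eq_iff imat_mult_def imat_minus_def right_diff_distrib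
      infsum_minus_distrib imat_mult_summable assms)

section \<open>Off-diagonal blocks and zero padding\<close>

lemma bounded_linf_op_block12:
  assumes "bounded_linf_op A" shows "bounded_linf_op (block12 k A)"
proof (rule bounded_linf_opI[where C = "imat_norm A"])
  show "(\<lambda>j. cmod (block12 k A i j)) summable_on UNIV" for i
    unfolding block12_def
    by (rule summable_on_inj_comp[OF bounded_linf_op_summable[OF assms]]) simp
  show "(\<Sum>\<^sub>\<infinity>j. cmod (block12 k A i j)) \<le> imat_norm A" for i
    unfolding block12_def
    using infsum_inj_comp_le[OF bounded_linf_op_summable[OF assms], of i "\<lambda>j. j + k"]
      imat_norm_upper[OF assms, of i] by simp
qed

lemma bounded_linf_op_block21: "bounded_linf_op A \<Longrightarrow> bounded_linf_op (block21 k A)"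
  by (rule bounded_linf_opI[where C = "imat_norm A"])
    (auto simp: block21_def bounded_linf_op_summable imat_norm_upper)

lemma pad_summable: "(\<lambda>j. cmod (pad M i j)) summable_on UNIV"
  and infsum_pad: "(\<Sum>\<^sub>\<infinity>j. cmod (pad M i j))
    = (if i < dim_row M then \<Sum>j < dim_col M. cmod (M $$ (i, j)) else 0)"
proof -
  have "(\<lambda>j. cmod (pad M i j)) summable_on UNIV
      \<longleftrightarrow> (\<lambda>j. cmod (pad M i j)) summable_on {..<dim_col M}"
    by (rule summable_on_cong_neutral) (auto simp: pad_def)
  then show "(\<lambda>j. cmod (pad M i j)) summable_on UNIV" by simp
  have "(\<Sum>\<^sub>\<infinity>j. cmod (pad M i j)) = (\<Sum>\<^sub>\<infinity>j\<in>{..<dim_col M}. cmod (pad M i j))"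
    by (rule infsum_cong_neutral) (auto simp: pad_def)
  then show "(\<Sum>\<^sub>\<infinity>j. cmod (pad M i j))
      = (if i < dim_row M then \<Sum>j < dim_col M. cmod (M $$ (i, j)) else 0)"
    by (simp add: pad_def)
qed

subsection \<open>Row sum norm of finite matrices\<close>

lemma mat_norm_upper:
  "i < dim_row M \<Longrightarrow> (\<Sum>j < dim_col M. cmod (M $$ (i, j))) \<le> mat_norm M"
  unfolding mat_norm_def by (rule Max_ge) auto

lemma mat_norm_least:
  assumes "0 < dim_row M"
    and "\<And>i. i < dim_row M \<Longrightarrow> (\<Sum>j < dim_col M. cmod (M $$ (i, j))) \<le> C"
  shows "mat_norm M \<le> C"
  unfolding mat_norm_def using assms by (subst Max_le_iff) auto

lemma mat_norm_nonneg: "0 < dim_row M \<Longrightarrow> 0 \<le> mat_norm M"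
  using mat_norm_upper[of 0 M] by (meson norm_ge_zero order_trans sum_nonneg)

lemma mat_norm_add_le:
  assumes "M \<in> carrier_mat n m" and "N \<in> carrier_mat n m" and "0 < n"
  shows "mat_norm (M + N) \<le> mat_norm M + mat_norm N"
proof (rule mat_norm_least)
  fix i assume "i < dim_row (M + N)"
  then have i: "i < n" using assms by simp
  have "(\<Sum>j < dim_col (M + N). cmod ((M + N) $$ (i, j)))
      = (\<Sum>j<m. cmod (M $$ (i, j) + N $$ (i, j)))"
    using i assms by simp
  also have "\<dots> \<le> (\<Sum>j<m. cmod (M $$ (i, j)) + cmod (N $$ (i, j)))"
    by (intro sum_mono norm_triangle_ineq)
  finally show "(\<Sum>j < dim_col (M + N). cmod ((M + N) $$ (i, j))) \<le> mat_norm M + mat_norm N"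
    using mat_norm_upper[of i M] mat_norm_upper[of i N] i assms by (simp add: sum.distrib)
qed (use assms in auto)

lemma mat_norm_mult_le:
  assumes M: "M \<in> carrier_mat n m" and N: "N \<in> carrier_mat m p" and "0 < n" "0 < m"
  shows "mat_norm (M * N) \<le> mat_norm M * mat_norm N"
proof (rule mat_norm_least)
  fix i assume "i < dim_row (M * N)"
  then have i: "i < n" using M by simp
  have "(\<Sum>j < dim_col (M * N). cmod ((M * N) $$ (i, j)))
      \<le> (\<Sum>j<p. \<Sum>l<m. cmod (M $$ (i, l)) * cmod (N $$ (l, j)))"
    using i M N
    by (auto simp: scalar_prod_def atLeast0LessThan norm_mult
        intro!: sum_mono order_trans[OF norm_sum])
  also have "\<dots> = (\<Sum>l<m. cmod (M $$ (i, l)) * (\<Sum>j<p. cmod (N $$ (l, j))))"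
    by (subst sum.swap) (simp add: sum_distrib_left)
  also have "\<dots> \<le> (\<Sum>l<m. cmod (M $$ (i, l)) * mat_norm N)"
    using N mat_norm_upper[of _ N] by (intro sum_mono mult_left_mono) auto
  also have "\<dots> = (\<Sum>l<m. cmod (M $$ (i, l))) * mat_norm N"
    by (simp add: sum_distrib_right)
  also have "\<dots> \<le> mat_norm M * mat_norm N"
    using M N i \<open>0 < m\<close> mat_norm_upper[of i M] mat_norm_nonneg[of N]
    by (intro mult_right_mono) auto
  finally show "(\<Sum>j < dim_col (M * N). cmod ((M * N) $$ (i, j))) \<le> mat_norm M * mat_norm N" .
qed (use assms in auto)

lemma mat_norm_smult:
  assumes "0 < dim_row M"
  shows "mat_norm (c \<cdot>\<^sub>m M) \<le> cmod c * mat_norm M"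
  using assms mat_norm_upper[of _ M]
  by (intro mat_norm_least) (auto simp: norm_mult sum_distrib_left[symmetric] intro!: mult_left_mono)

lemma mat_norm_one: "0 < n \<Longrightarrow> mat_norm (1\<^sub>m n) \<le> 1"
proof (rule mat_norm_least)
  fix i assume "i < dim_row (1\<^sub>m n)"
  then show "(\<Sum>j < dim_col (1\<^sub>m n). cmod (1\<^sub>m n $$ (i, j))) \<le> 1"
    by (simp add: if_distrib cong: if_cong)
qed auto

lemma bounded_linf_op_pad: "bounded_linf_op (pad M)"
proof (rule bounded_linf_opI[OF pad_summable])
  \<comment> \<open>The absolute value makes the bound nonnegative, as the zero rows of the padding
    demand, even if \<open>M\<close> has no rows and \<open>mat_norm M\<close> is a
    \<open>Max\<close> over the empty set.\<close>
  show "(\<Sum>\<^sub>\<infinity>j. cmod (pad M i j)) \<le> \<bar>mat_norm M\<bar>" for i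
    using mat_norm_upper[of i M] by (auto simp: infsum_pad)
qed

lemma imat_norm_pad_le: "0 < dim_row M \<Longrightarrow> imat_norm (pad M) \<le> mat_norm M"
  by (rule imat_norm_least) (auto simp: infsum_pad mat_norm_upper mat_norm_nonneg)

subsection \<open>Leading blocks\<close>

lemma lead_carrier [simp]: "lead k A \<in> carrier_mat k k"
  by (simp add: lead_def)

lemma lead_dim [simp]: "dim_row (lead k A) = k" "dim_col (lead k A) = k"
  by (simp_all add: lead_def)

lemma lead_index [simp]: "i < k \<Longrightarrow> j < k \<Longrightarrow> lead k A $$ (i, j) = A i j"
  by (simp add: lead_def)

lemma mat_norm_lead_le:
  assumes "bounded_linf_op A" and "0 < k"
  shows "mat_norm (lead k A) \<le> imat_norm A"
proof (rule mat_norm_least)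
  fix i assume "i < dim_row (lead k A)"
  then show "(\<Sum>j < dim_col (lead k A). cmod (lead k A $$ (i, j))) \<le> imat_norm A"
    using sum_le_infsum_UNIV[OF bounded_linf_op_summable[OF assms(1)], of i "{..<k}"]
      imat_norm_upper[OF assms(1), of i]
    by (simp add: lead_def)
qed (use assms in \<open>simp add: lead_def\<close>)

text \<open>The summation index of the product is split at \<open>k\<close>; the tail, shifted by
  \<open>k\<close>, is the product of the off-diagonal blocks.\<close>

lemma lead_mult:
  assumes "bounded_linf_op A" and "bounded_linf_op B"
  shows "lead k (A *\<^sub>\<infinity> B) = lead k A * lead k B + lead k (block12 k A *\<^sub>\<infinity> block21 k B)"
proof (rule eq_matI)
  fix i j
  assume "i < dim_row (lead k A * lead k B + lead k (block12 k A *\<^sub>\<infinity> block21 k B))"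
    and "j < dim_col (lead k A * lead k B + lead k (block12 k A *\<^sub>\<infinity> block21 k B))"
  then have ij: "i < k" "j < k" by (simp_all add: lead_def)
  let ?f = "\<lambda>l. A i l * B l j"
  have s: "?f summable_on X" for X
    using imat_mult_summable[OF assms] by (rule summable_on_subset_banach) simp
  have U: "UNIV = {..<k} \<union> range (\<lambda>l. l + k)"
    by (metis UNIV_I UnI1 UnI2 le_add_diff_inverse2 lessThan_iff not_le_imp_less rangeI subsetI
        subset_antisym)
  have "infsum ?f UNIV = infsum ?f {..<k} + infsum ?f (range (\<lambda>l. l + k))"
    by (subst U, rule infsum_Un_disjoint[OF s s]) auto
  also have "infsum ?f (range (\<lambda>l. l + k)) = (\<Sum>\<^sub>\<infinity>l. A i (l + k) * B (l + k) j)"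
    by (subst infsum_reindex) (auto simp: o_def)
  finally show "lead k (A *\<^sub>\<infinity> B) $$ (i, j)
      = (lead k A * lead k B + lead k (block12 k A *\<^sub>\<infinity> block21 k B)) $$ (i, j)"
    using ij
    by (simp add: lead_def imat_mult_def block12_def block21_def scalar_prod_def
        atLeast0LessThan)
qed (simp_all add: lead_def)

text \<open>Summability of the inner sum is part of the conclusion because \<open>infsum_add\<close>
  asks for it in the induction step.\<close>

lemma sum_infsum_swap:
  fixes f :: "'a \<Rightarrow> 'b \<Rightarrow> 'c::{topological_comm_monoid_add, t2_space}"
  assumes "finite J" and "\<And>j. j \<in> J \<Longrightarrow> f j summable_on X"
  shows "(\<Sum>j\<in>J. \<Sum>\<^sub>\<infinity>x\<in>X. f j x) = (\<Sum>\<^sub>\<infinity>x\<in>X. \<Sum>j\<in>J. f j x)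
    \<and> (\<lambda>x. \<Sum>j\<in>J. f j x) summable_on X"
  using assms by (induction J rule: finite_induct) (auto simp: infsum_add intro: summable_on_add)

text \<open>A leading block of \<open>X\<close> times \<open>Y\<close> sees only the first
  \<open>k\<close> rows of \<open>X\<close> and the first \<open>k\<close> columns of
  \<open>Y\<close>, but every row of \<open>Y\<close>. The bounds \<open>x\<close> and
  \<open>y\<close> are restricted accordingly, which fits the conventions of \<open>block12\<close>
  and \<open>block21\<close>.\<close>

lemma mat_norm_lead_mult_le:
  assumes X: "bounded_linf_op X" and Y: "bounded_linf_op Y" and "0 < k"
    and x: "\<And>i. i < k \<Longrightarrow> (\<Sum>\<^sub>\<infinity>l. cmod (X i l)) \<le> x"
    and y: "\<And>l. (\<Sum>j<k. cmod (Y l j)) \<le> y"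
  shows "mat_norm (lead k (X *\<^sub>\<infinity> Y)) \<le> x * y"
proof (rule mat_norm_least)
  fix i assume "i < dim_row (lead k (X *\<^sub>\<infinity> Y))"
  then have i: "i < k" by (simp add: lead_def)
  have y0: "0 \<le> y" using y[of 0] by (meson norm_ge_zero order_trans sum_nonneg)
  note s = imat_mult_abs_summable[OF X Y, of i]
  have sw: "(\<Sum>j<k. \<Sum>\<^sub>\<infinity>l. cmod (X i l * Y l j)) = (\<Sum>\<^sub>\<infinity>l. \<Sum>j<k. cmod (X i l * Y l j))"
    "(\<lambda>l. \<Sum>j<k. cmod (X i l * Y l j)) summable_on UNIV"
    using sum_infsum_swap[of "{..<k}" "\<lambda>j l. cmod (X i l * Y l j)" UNIV] s by auto
  have "(\<Sum>j < dim_col (lead k (X *\<^sub>\<infinity> Y)). cmod (lead k (X *\<^sub>\<infinity> Y) $$ (i, j)))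
      \<le> (\<Sum>j<k. \<Sum>\<^sub>\<infinity>l. cmod (X i l * Y l j))"
    using i by (auto simp: lead_def imat_mult_def intro!: sum_mono norm_infsum_bound s)
  also have "\<dots> \<le> (\<Sum>\<^sub>\<infinity>l. cmod (X i l) * y)"
    unfolding sw(1)
  proof (rule infsum_mono[OF sw(2)])
    show "(\<lambda>l. cmod (X i l) * y) summable_on UNIV"
      by (intro summable_on_cmult_left bounded_linf_op_summable X)
    show "(\<Sum>j<k. cmod (X i l * Y l j)) \<le> cmod (X i l) * y" for l
      using y[of l] by (auto simp: norm_mult sum_distrib_left[symmetric] intro!: mult_left_mono)
  qed
  also have "\<dots> = (\<Sum>\<^sub>\<infinity>l. cmod (X i l)) * y"
    by (intro infsum_cmult_left bounded_linf_op_summable X)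
  also have "\<dots> \<le> x * y"
    using x[OF i] y0 by (rule mult_right_mono)
  finally show "(\<Sum>j < dim_col (lead k (X *\<^sub>\<infinity> Y)). cmod (lead k (X *\<^sub>\<infinity> Y) $$ (i, j))) \<le> x * y" .
qed (use \<open>0 < k\<close> in \<open>simp add: lead_def\<close>)

subsection \<open>Nonnegative matrices of spectral radius less than one\<close>

lemma nonneg_Reals_iff_Re_Im: "z \<in> \<real>\<^sub>\<ge>\<^sub>0 \<longleftrightarrow> 0 \<le> Re z \<and> Im z = 0"
proof
  assume "0 \<le> Re z \<and> Im z = 0"
  then have "z = of_real (Re z)" "0 \<le> Re z" by (simp_all add: complex_eq_iff)
  then show "z \<in> \<real>\<^sub>\<ge>\<^sub>0" by (metis nonneg_Reals_of_real_iff)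
qed (auto simp: nonneg_Reals_def)

lemma mat_nonneg_index:
  assumes "mat_nonneg M" and "i < dim_row M" and "j < dim_col M"
  shows "0 \<le> Re (M $$ (i, j))" and "Im (M $$ (i, j)) = 0"
  using assms by (auto simp: mat_nonneg_def nonneg_Reals_iff_Re_Im)

lemma mat_nonneg_mult:
  assumes "mat_nonneg M" and "mat_nonneg N" and "dim_col M = dim_row N"
  shows "mat_nonneg (M * N)"
  using assms by (auto simp: mat_nonneg_def nonneg_Reals_iff_Re_Im scalar_prod_def intro!: sum_nonneg)

lemma mat_nonneg_pow:
  assumes "S \<in> carrier_mat n n" and "mat_nonneg S"
  shows "mat_nonneg (S ^\<^sub>m m)"
proof (induction m)
  case 0
  then show ?case using assms(1) by (auto simp: mat_nonneg_def)
next
  case (Suc m)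
  then show ?case using assms by (auto intro: mat_nonneg_mult)
qed

text \<open>An eigenvector of \<open>S\<close> divided by \<open>r\<close> for the eigenvalue
  \<open>x\<close> is an eigenvector of \<open>S\<close> for \<open>r * x\<close>, whose modulus is
  less than \<open>r\<close>.\<close>

lemma spectral_radius_smult_less_1:
  assumes S: "S \<in> carrier_mat n n" and n: "0 < n" and r: "0 < r" and less: "spectral_radius S < r"
  shows "spectral_radius (complex_of_real (1 / r) \<cdot>\<^sub>m S) < 1"
proof -
  let ?c = "complex_of_real (1 / r)"
  have M: "?c \<cdot>\<^sub>m S \<in> carrier_mat n n" using S by simp
  obtain x where x: "x \<in> spectrum (?c \<cdot>\<^sub>m S)" "spectral_radius (?c \<cdot>\<^sub>m S) = cmod x"
    using spectral_radius_mem_max(1)[OF M n] by auto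
  then obtain v where v: "eigenvector (?c \<cdot>\<^sub>m S) v x"
    unfolding spectrum_def eigenvalue_def by auto
  then have vn: "v \<in> carrier_vec n" "v \<noteq> 0\<^sub>v n" and e: "(?c \<cdot>\<^sub>m S) *\<^sub>v v = x \<cdot>\<^sub>v v"
    using S by (auto simp: eigenvector_def)
  have "S *\<^sub>v v = of_real r \<cdot>\<^sub>v ((?c \<cdot>\<^sub>m S) *\<^sub>v v)"
    using S vn r by (intro eq_vecI) (auto simp: smult_scalar_prod_distrib[of _ n])
  then have "S *\<^sub>v v = (of_real r * x) \<cdot>\<^sub>v v"
    unfolding e by (simp add: smult_smult_assoc)
  then have "of_real r * x \<in> spectrum S"
    using S vn unfolding spectrum_def eigenvalue_def eigenvector_def by auto
  then have "cmod (of_real r * x) \<le> spectral_radius S"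
    using spectral_radius_mem_max(2)[OF S n] by blast
  then have "r * cmod x < r * 1" using less r unfolding norm_mult norm_of_real by linarith
  then have "cmod x < 1" by (rule mult_less_cancel_left_pos[OF r, THEN iffD1])
  then show ?thesis using x(2) by simp
qed

text \<open>A discrete maximum principle: since \<open>S\<close> is nonnegative, the inequality
  between \<open>w\<close> and its image under \<open>S\<close> can be iterated, and the powers of
  \<open>S\<close> tend to zero.\<close>

lemma subinvariant_nonpos:
  fixes w :: "nat \<Rightarrow> real"
  assumes S: "S \<in> carrier_mat n n" and nn: "mat_nonneg S" and rho: "spectral_radius S < 1"
    and w: "\<And>i. i < n \<Longrightarrow> w i \<le> (\<Sum>j<n. Re (S $$ (i, j)) * w j)"
    and i: "i < n"
  shows "w i \<le> 0"
proof -
  \<comment> \<open>The library only bounds the powers of a matrix of spectral radius below 1; dividing by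
    some \<open>r\<close> between the spectral radius and 1 turns this into decay.\<close>
  define r where "r = max (1 / 2) ((1 + spectral_radius S) / 2)"
  have r: "0 < r" "spectral_radius S < r" "r < 1"
    using rho by (simp_all add: r_def max_def field_simps)
  define M where "M = complex_of_real (1 / r) \<cdot>\<^sub>m S"
  have M: "M \<in> carrier_mat n n" using S by (simp add: M_def)
  have Mnn: "mat_nonneg M"
    using nn r unfolding M_def mat_nonneg_def
    by (auto simp: nonneg_Reals_iff_Re_Im)
  have wM: "w l \<le> r * (\<Sum>j<n. Re (M $$ (l, j)) * w j)" if "l < n" for l
    using w[OF that] that S r by (simp add: M_def sum_distrib_left)
  obtain c where "\<And>m. norm_bound (M ^\<^sub>m m) c"
    using spectral_radius_jnf_norm_bound_less_1_upper_triangular[OF M]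
      spectral_radius_smult_less_1[OF S _ r(1,2)] i unfolding M_def by auto
  then have c: "cmod ((M ^\<^sub>m m) $$ (l, j)) \<le> c" if "l < n" "j < n" for m l j
    using that M unfolding norm_bound_def by (metis pow_mat_dim_square)
  \<comment> \<open>The powers of \<open>M\<close> are nonnegative, so inserting \<open>wM\<close>
    into the sum preserves the inequality. Each round contributes one more factor
    \<open>r\<close>.\<close>
  have iter: "w i \<le> r ^ m * (\<Sum>j<n. Re ((M ^\<^sub>m m) $$ (i, j)) * w j)" if "i < n" for m i
  proof (induction m)
    case 0
    have "(\<Sum>j<n. Re (1\<^sub>m n $$ (i, j)) * w j) = (\<Sum>j<n. if j = i then w j else 0)"
      using that by (intro sum.cong) auto
    then show ?case using that M by simp
  next
    case (Suc m)
    have Mm: "M ^\<^sub>m m \<in> carrier_mat n n" using M by simp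
    have "(\<Sum>l<n. Re ((M ^\<^sub>m m) $$ (i, l)) * w l)
        \<le> (\<Sum>l<n. Re ((M ^\<^sub>m m) $$ (i, l)) * (r * (\<Sum>j<n. Re (M $$ (l, j)) * w j)))"
      using that wM M
      by (intro sum_mono mult_left_mono mat_nonneg_index(1)[OF mat_nonneg_pow[OF M Mnn]]) auto
    also have "\<dots> = r * (\<Sum>j<n. (\<Sum>l<n. Re ((M ^\<^sub>m m) $$ (i, l)) * Re (M $$ (l, j))) * w j)"
      unfolding sum_distrib_left sum_distrib_right
      by (subst sum.swap) (simp add: mult_ac)
    also have "\<dots> = r * (\<Sum>j<n. Re ((M ^\<^sub>m Suc m) $$ (i, j)) * w j)"
    proof -
      \<comment> \<open>Real parts multiply here because the entries of \<open>M\<close> are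
        real.\<close>
      have "Re ((M ^\<^sub>m Suc m) $$ (i, j)) = (\<Sum>l<n. Re ((M ^\<^sub>m m) $$ (i, l)) * Re (M $$ (l, j)))"
        if "j < n" for j
        using \<open>i < n\<close> that M Mm mat_nonneg_index(2)[OF Mnn, of _ j]
        by (simp add: scalar_prod_def atLeast0LessThan)
      then show ?thesis by simp
    qed
    finally have "r ^ m * (\<Sum>l<n. Re ((M ^\<^sub>m m) $$ (i, l)) * w l)
        \<le> r ^ m * (r * (\<Sum>j<n. Re ((M ^\<^sub>m Suc m) $$ (i, j)) * w j))"
      using r by (intro mult_left_mono) auto
    then show ?case using Suc by (simp add: mult_ac)
  qed
  \<comment> \<open>With all powers of \<open>M\<close> bounded entrywise by \<open>c\<close>, the
    only factor left that depends on \<open>m\<close> is \<open>r ^ m\<close>.\<close>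
  have le: "w i \<le> r ^ m * (\<Sum>j<n. c * \<bar>w j\<bar>)" for m
  proof -
    have "(\<Sum>j<n. Re ((M ^\<^sub>m m) $$ (i, j)) * w j) \<le> (\<Sum>j<n. c * \<bar>w j\<bar>)"
    proof (rule sum_mono)
      fix j assume "j \<in> {..<n}"
      then have "\<bar>Re ((M ^\<^sub>m m) $$ (i, j))\<bar> \<le> c"
        using c[OF i] abs_Re_le_cmod order_trans by blast
      then have "\<bar>Re ((M ^\<^sub>m m) $$ (i, j))\<bar> * \<bar>w j\<bar> \<le> c * \<bar>w j\<bar>"
        by (rule mult_right_mono) simp
      then show "Re ((M ^\<^sub>m m) $$ (i, j)) * w j \<le> c * \<bar>w j\<bar>"
        by (metis abs_ge_self abs_mult order_trans)
    qed
    then have "r ^ m * (\<Sum>j<n. Re ((M ^\<^sub>m m) $$ (i, j)) * w j) \<le> r ^ m * (\<Sum>j<n. c * \<bar>w j\<bar>)"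
      using r by (intro mult_left_mono) auto
    with iter[OF i, of m] show ?thesis by linarith
  qed
  have "(\<lambda>m. r ^ m * (\<Sum>j<n. c * \<bar>w j\<bar>)) \<longlonglongrightarrow> 0"
    using r by (intro tendsto_mult_left_zero LIMSEQ_power_zero) simp
  then show ?thesis
    by (rule LIMSEQ_le_const) (use le in blast)
qed

text \<open>Let \<open>s\<close> be the vector of row sums of \<open>S\<close>. The bound on
  \<open>2 S - S S\<close> gives \<open>2 s - S s \<le> 1\<close>, which rearranges to
  \<open>s - 1 \<le> S (s - 1)\<close>. So \<open>subinvariant_nonpos\<close> applies to
  \<open>s - 1\<close>.\<close>

lemma mat_norm_sqrt_le_1:
  assumes S: "S \<in> carrier_mat n n" and n: "0 < n" and nn: "mat_nonneg S"
    and rho: "spectral_radius S < 1"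
    and P: "mat_norm (2 \<cdot>\<^sub>m S - S * S) \<le> 1"
  shows "mat_norm S \<le> 1"
proof (rule mat_norm_least)
  define s where "s i = (\<Sum>j<n. Re (S $$ (i, j)))" for i
  have "s i - 1 \<le> (\<Sum>j<n. Re (S $$ (i, j)) * (s j - 1))" if i: "i < n" for i
  proof -
    have "Re ((S * S) $$ (i, j)) = (\<Sum>l<n. Re (S $$ (i, l)) * Re (S $$ (l, j)))"
      if "j < n" for j
      using i that S mat_nonneg_index(2)[OF nn, of i] by (simp add: scalar_prod_def atLeast0LessThan)
    then have "(\<Sum>j<n. Re ((S * S) $$ (i, j)))
        = (\<Sum>j<n. \<Sum>l<n. Re (S $$ (i, l)) * Re (S $$ (l, j)))"
      by simp
    also have "\<dots> = (\<Sum>l<n. Re (S $$ (i, l)) * s l)"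
      by (subst sum.swap) (simp add: s_def sum_distrib_left)
    finally have SS: "(\<Sum>j<n. Re ((S * S) $$ (i, j))) = (\<Sum>l<n. Re (S $$ (i, l)) * s l)" .
    have "2 * s i - (\<Sum>j<n. Re ((S * S) $$ (i, j))) = (\<Sum>j<n. Re ((2 \<cdot>\<^sub>m S - S * S) $$ (i, j)))"
      using i S
      by (simp add: s_def sum_distrib_left sum_subtractf[symmetric] del: index_mult_mat(1))
    also have "\<dots> \<le> (\<Sum>j<n. cmod ((2 \<cdot>\<^sub>m S - S * S) $$ (i, j)))"
      by (intro sum_mono complex_Re_le_cmod)
    also have "\<dots> \<le> 1"
      using mat_norm_upper[of i "2 \<cdot>\<^sub>m S - S * S"] i S P by (simp del: index_mult_mat(1))
    finally have "2 * s i - (\<Sum>l<n. Re (S $$ (i, l)) * s l) \<le> 1" unfolding SS .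
    moreover have "(\<Sum>j<n. Re (S $$ (i, j)) * (s j - 1)) = (\<Sum>l<n. Re (S $$ (i, l)) * s l) - s i"
      by (simp add: s_def right_diff_distrib sum_subtractf)
    ultimately show ?thesis by linarith
  qed
  then have s1: "s i - 1 \<le> 0" if "i < n" for i
    using subinvariant_nonpos[OF S nn rho, of "\<lambda>i. s i - 1" i] that by simp
  show "(\<Sum>j < dim_col S. cmod (S $$ (i, j))) \<le> 1" if "i < dim_row S" for i
  proof -
    have i: "i < n" using that S by simp
    have "cmod (S $$ (i, j)) = Re (S $$ (i, j))" if "j < n" for j
      using mat_nonneg_index[OF nn, of i j] i S that by (simp add: cmod_eq_Re)
    then have "(\<Sum>j < dim_col S. cmod (S $$ (i, j))) = s i"
      using S by (simp add: s_def)
    then show ?thesis using s1[OF i] by simp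
  qed
qed (use S n in simp)

text \<open>The inverse satisfies \<open>N = (I + N S) / 2\<close>. Hence its norm is at most the
  mean of 1 and itself, which forces it to be at most 1. A Neumann series is avoided.\<close>

lemma mat_norm_inverse_two_minus_le_1:
  assumes S: "S \<in> carrier_mat n n" and N: "N \<in> carrier_mat n n" and n: "0 < n"
    and inv: "N * (2 \<cdot>\<^sub>m 1\<^sub>m n - S) = 1\<^sub>m n" and S1: "mat_norm S \<le> 1"
  shows "mat_norm N \<le> 1"
proof -
  have "N * (2 \<cdot>\<^sub>m 1\<^sub>m n - S) = 2 \<cdot>\<^sub>m N - N * S"
    using S N by (simp add: mult_minus_distrib_mat[of _ n n _ n] mult_smult_distrib[of _ n n _ n])
  then have eq: "2 \<cdot>\<^sub>m N - N * S = 1\<^sub>m n" using inv by simp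
  have "N = (1 / 2) \<cdot>\<^sub>m (1\<^sub>m n + N * S)"
    unfolding eq[symmetric] using S N by (intro eq_matI) (auto simp del: index_mult_mat(1))
  then have "mat_norm N \<le> cmod (1 / 2) * mat_norm (1\<^sub>m n + N * S)"
    using mat_norm_smult[of "1\<^sub>m n + N * S" "1 / 2"] S N n by simp
  moreover have "mat_norm (1\<^sub>m n + N * S) \<le> mat_norm (1\<^sub>m n :: complex mat) + mat_norm (N * S)"
    by (rule mat_norm_add_le) (use S N n in auto)
  moreover have "mat_norm (N * S) \<le> mat_norm N * mat_norm S"
    by (rule mat_norm_mult_le[OF N S n n])
  moreover have "mat_norm N * mat_norm S \<le> mat_norm N"
    using S1 mat_norm_nonneg[of N] N n by (simp add: mult_left_le)
  ultimately show ?thesis using mat_norm_one[OF n] by simp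
qed

subsection \<open>Perturbation of the square root\<close>

text \<open>This completes the square: the left side of \<open>eq\<close> equals
  \<open>(T + G) (T + G) - T T - 2 G\<close>. The term \<open>T T + P\<close> is the form that the
  leading block of the squared Toeplitz matrix takes.\<close>

lemma riccati_imp_sqrt:
  fixes T G A P :: "complex mat"
  assumes c: "T \<in> carrier_mat n n" "G \<in> carrier_mat n n" "A \<in> carrier_mat n n" "P \<in> carrier_mat n n"
    and eq: "G * G - (1\<^sub>m n - T) * G - G * (1\<^sub>m n - T) = 2 \<cdot>\<^sub>m T - A - (T * T + P)"
  shows "A + P = 2 \<cdot>\<^sub>m (T + G) - (T + G) * (T + G)"
proof (rule eq_matI)
  have "(1\<^sub>m n - T) * G = G - T * G" "G * (1\<^sub>m n - T) = G - G * T"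
    using c by (simp_all add: minus_mult_distrib_mat[of _ n n _ _ n] mult_minus_distrib_mat[of _ n n _ n])
  with eq have eq': "G * G - (G - T * G) - (G - G * T) = 2 \<cdot>\<^sub>m T - A - (T * T + P)" by simp
  have exp: "(T + G) * (T + G) = T * T + G * T + (T * G + G * G)"
    using c by (simp add: add_mult_distrib_mat[of _ n n _ _ n] mult_add_distrib_mat[of _ n n _ n])
  fix i j
  assume "i < dim_row (2 \<cdot>\<^sub>m (T + G) - (T + G) * (T + G))"
    and "j < dim_col (2 \<cdot>\<^sub>m (T + G) - (T + G) * (T + G))"
  then have ij: "i < n" "j < n" using c by simp_all
  \<comment> \<open>Entrywise the identity is linear over the complex numbers once the entries of
    products stay opaque, hence the deletion of \<open>index_mult_mat(1)\<close>.\<close>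
  from arg_cong[OF eq', of "\<lambda>M. M $$ (i, j)"]
  show "(A + P) $$ (i, j) = (2 \<cdot>\<^sub>m (T + G) - (T + G) * (T + G)) $$ (i, j)"
    unfolding exp using ij c by (simp add: algebra_simps del: index_mult_mat(1))
qed (use c in auto)

text \<open>\<open>S\<close> and \<open>X\<close> need not commute. With \<open>S\<close> kept on
  the left and \<open>X\<close> on the right the mixed term \<open>S X\<close> occurs on both sides
  and cancels, and the rest is the difference of the two square root equations.\<close>

lemma sqrt_difference:
  fixes S X A P Q :: "complex mat"
  assumes c: "S \<in> carrier_mat n n" "X \<in> carrier_mat n n" "A \<in> carrier_mat n n"
      "P \<in> carrier_mat n n" "Q \<in> carrier_mat n n"
    and S: "A + P = 2 \<cdot>\<^sub>m S - S * S" and X: "A + Q = 2 \<cdot>\<^sub>m X - X * X"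
  shows "(2 \<cdot>\<^sub>m 1\<^sub>m n - S) * (S - X) = (S - X) * X + (P - Q)"
proof (rule eq_matI)
  have "(2 \<cdot>\<^sub>m 1\<^sub>m n - S) * (S - X) = (2 \<cdot>\<^sub>m 1\<^sub>m n) * (S - X) - S * (S - X)"
    by (rule minus_mult_distrib_mat) (use c in auto)
  also have "(2 \<cdot>\<^sub>m 1\<^sub>m n) * (S - X) = 2 \<cdot>\<^sub>m (1\<^sub>m n * (S - X))"
    by (rule mult_smult_assoc_mat) (use c in auto)
  also have "1\<^sub>m n * (S - X) = S - X"
    by (rule left_mult_one_mat) (use c in auto)
  also have "S * (S - X) = S * S - S * X"
    by (rule mult_minus_distrib_mat) (use c in auto)
  finally have l: "(2 \<cdot>\<^sub>m 1\<^sub>m n - S) * (S - X) = 2 \<cdot>\<^sub>m (S - X) - (S * S - S * X)" .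
  have r: "(S - X) * X = S * X - X * X"
    using c by (simp add: minus_mult_distrib_mat[of _ n n _ _ n])
  fix i j
  assume "i < dim_row ((S - X) * X + (P - Q))" and "j < dim_col ((S - X) * X + (P - Q))"
  then have ij: "i < n" "j < n" using c by simp_all
  have P: "P $$ (i, j) = 2 * S $$ (i, j) - (S * S) $$ (i, j) - A $$ (i, j)"
    using arg_cong[OF S, of "\<lambda>M. M $$ (i, j)"] ij c
    by (simp add: algebra_simps del: index_mult_mat(1))
  have Q: "Q $$ (i, j) = 2 * X $$ (i, j) - (X * X) $$ (i, j) - A $$ (i, j)"
    using arg_cong[OF X, of "\<lambda>M. M $$ (i, j)"] ij c
    by (simp add: algebra_simps del: index_mult_mat(1))
  show "((2 \<cdot>\<^sub>m 1\<^sub>m n - S) * (S - X)) $$ (i, j) = ((S - X) * X + (P - Q)) $$ (i, j)"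
    unfolding l r using ij c by (simp add: P Q right_diff_distrib del: index_mult_mat(1))
qed (use c in auto)

text \<open>From \<open>D = N (D X + R)\<close> the norm of \<open>D\<close> is bounded by an
  expression containing itself; \<open>less\<close> allows that term to be absorbed on the
  left.\<close>

lemma sylvester_norm_bound:
  fixes M N D X R :: "complex mat"
  assumes c: "M \<in> carrier_mat n n" "N \<in> carrier_mat n n" "D \<in> carrier_mat n n"
      "X \<in> carrier_mat n n" "R \<in> carrier_mat n n" and n: "0 < n"
    and inv: "N * M = 1\<^sub>m n" and eq: "M * D = D * X + R"
    and less: "mat_norm N * mat_norm X < 1"
  shows "mat_norm D \<le> mat_norm N / (1 - mat_norm N * mat_norm X) * mat_norm R"
proof -
  have N0: "0 \<le> mat_norm N" using mat_norm_nonneg[of N] c n by simp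
  have "D = N * (M * D)"
    using c inv by (metis assoc_mult_mat left_mult_one_mat)
  then have "mat_norm D \<le> mat_norm N * mat_norm (D * X + R)"
    using mat_norm_mult_le[of N n n "D * X + R" n] c n eq by simp
  moreover have "mat_norm (D * X + R) \<le> mat_norm D * mat_norm X + mat_norm R"
    using mat_norm_add_le[of "D * X" n n R] mat_norm_mult_le[of D n n X n] c n by fastforce
  ultimately have "mat_norm D \<le> mat_norm N * (mat_norm D * mat_norm X + mat_norm R)"
    using N0 by (meson mult_left_mono order_trans)
  then have "mat_norm D * (1 - mat_norm N * mat_norm X) \<le> mat_norm N * mat_norm R"
    by (simp add: algebra_simps)
  then show ?thesis using less by (simp add: field_simps)
qed

section \<open>The square root equation of \<open>B\<close> and its leading block\<close>

lemma imat_sqrt_eq: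
  assumes B: "bounded_linf_op B" and eq: "(1\<^sub>\<infinity> -\<^sub>\<infinity> B) *\<^sub>\<infinity> (1\<^sub>\<infinity> -\<^sub>\<infinity> B) = 1\<^sub>\<infinity> -\<^sub>\<infinity> A1"
  shows "A1 = 2 \<cdot>\<^sub>\<infinity> B -\<^sub>\<infinity> B *\<^sub>\<infinity> B"
proof (intro ext)
  fix i j
  have "(1\<^sub>\<infinity> -\<^sub>\<infinity> B) *\<^sub>\<infinity> (1\<^sub>\<infinity> -\<^sub>\<infinity> B) = (1\<^sub>\<infinity> -\<^sub>\<infinity> B) -\<^sub>\<infinity> (B -\<^sub>\<infinity> B *\<^sub>\<infinity> B)"
    by (simp add: imat_minus_mult_distrib imat_mult_minus_distrib bounded_linf_op_one
        bounded_linf_op_minus B imat_one_mult imat_mult_one)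
  from fun_cong[OF fun_cong[OF this[unfolded eq], of i], of j]
  show "A1 i j = (2 \<cdot>\<^sub>\<infinity> B -\<^sub>\<infinity> B *\<^sub>\<infinity> B) i j"
    by (simp add: imat_minus_def imat_smult_def algebra_simps)
qed

text \<open>The off-diagonal product is what the leading block of the square of \<open>B\<close> has
  beyond the square of the leading block. Moved to the left, it gives the equation of
  \<open>lead k B\<close> the same shape as that of \<open>T11 + G\<close>.\<close>

lemma lead_sqrt_eq:
  assumes B: "bounded_linf_op B" and A1: "A1 = 2 \<cdot>\<^sub>\<infinity> B -\<^sub>\<infinity> B *\<^sub>\<infinity> B"
  shows "lead k A1 + lead k (block12 k B *\<^sub>\<infinity> block21 k B)
    = 2 \<cdot>\<^sub>m lead k B - lead k B * lead k B"
proof -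
  have "lead k A1 = 2 \<cdot>\<^sub>m lead k B - lead k (B *\<^sub>\<infinity> B)"
    by (intro eq_matI) (auto simp: A1 lead_def imat_minus_def imat_smult_def)
  moreover have "lead k B * lead k B \<in> carrier_mat k k"
    by (rule mult_carrier_mat) (rule lead_carrier)+
  ultimately show ?thesis
    unfolding lead_mult[OF B B]
    by (intro eq_matI) (auto simp del: index_mult_mat(1) simp: lead_def)
qed

text \<open>With \<open>F = pad (lead k E) - E\<close>, the blocks \<open>E\<^sub>1\<^sub>2\<close> and
  \<open>E\<^sub>2\<^sub>1\<close> are blocks of \<open>- F\<close>.\<close>

lemma block12_row_sum_le:
  assumes E: "bounded_linf_op E" and i: "i < k"
  shows "(\<Sum>\<^sub>\<infinity>l. cmod (block12 k E i l)) \<le> imat_norm (pad (lead k E) -\<^sub>\<infinity> E)"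
proof -
  let ?F = "pad (lead k E) -\<^sub>\<infinity> E"
  have F: "bounded_linf_op ?F" by (rule bounded_linf_op_minus[OF bounded_linf_op_pad E])
  have "(\<Sum>\<^sub>\<infinity>l. cmod (block12 k E i l)) = (\<Sum>\<^sub>\<infinity>l. cmod (?F i (l + k)))"
    by (simp add: block12_def imat_minus_def pad_def lead_def)
  also have "\<dots> \<le> (\<Sum>\<^sub>\<infinity>l. cmod (?F i l))"
    by (rule infsum_inj_comp_le[OF bounded_linf_op_summable[OF F]]) simp_all
  also have "\<dots> \<le> imat_norm ?F" by (rule imat_norm_upper[OF F])
  finally show ?thesis .
qed

lemma block21_row_sum_le:
  assumes E: "bounded_linf_op E"
  shows "(\<Sum>j<k. cmod (block21 k E l j)) \<le> imat_norm (pad (lead k E) -\<^sub>\<infinity> E)"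
proof -
  let ?F = "pad (lead k E) -\<^sub>\<infinity> E"
  have F: "bounded_linf_op ?F" by (rule bounded_linf_op_minus[OF bounded_linf_op_pad E])
  have "(\<Sum>j<k. cmod (block21 k E l j)) = (\<Sum>j<k. cmod (?F (l + k) j))"
    by (simp add: block21_def imat_minus_def pad_def lead_def)
  also have "\<dots> \<le> (\<Sum>\<^sub>\<infinity>j. cmod (?F (l + k) j))"
    by (rule sum_le_infsum_UNIV[OF bounded_linf_op_summable[OF F]]) simp_all
  also have "\<dots> \<le> imat_norm ?F" by (rule imat_norm_upper[OF F])
  finally show ?thesis .
qed

text \<open>Expanding the product for \<open>T + E\<close> leaves
  \<open>T12 E21 + E12 T21 + E12 E21\<close> up to sign. The two mixed terms give
  \<open>2 * wiener_norm b * e\<close> and the last one \<open>e * e\<close>.\<close>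

lemma block_product_perturbation:
  assumes b: "b \<in> wiener" and T: "T = toeplitz b" and E: "bounded_linf_op E" and k: "0 < k"
    and e: "imat_norm (pad (lead k E) -\<^sub>\<infinity> E) \<le> e"
  shows "mat_norm (lead k (block12 k T *\<^sub>\<infinity> block21 k T)
      - lead k (block12 k (T +\<^sub>\<infinity> E) *\<^sub>\<infinity> block21 k (T +\<^sub>\<infinity> E)))
    \<le> (2 * wiener_norm b + e) * e"
proof -
  let ?T12 = "block12 k T" and ?T21 = "block21 k T" and ?E12 = "block12 k E" and ?E21 = "block21 k E"
  have Tb: "bounded_linf_op T" unfolding T by (rule bounded_linf_op_toeplitz[OF b])
  note bd = bounded_linf_op_block12[OF Tb] bounded_linf_op_block12[OF E]
    bounded_linf_op_block21[OF Tb] bounded_linf_op_block21[OF E]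
  have T12: "(\<Sum>\<^sub>\<infinity>l. cmod (?T12 i l)) \<le> wiener_norm b" for i
    unfolding block12_def T
    using infsum_inj_comp_le[OF toeplitz_summable[OF b], of i "\<lambda>l. l + k"] toeplitz_row_sum_le[OF b, of i]
    by simp
  have T21: "(\<Sum>j<k. cmod (?T21 l j)) \<le> wiener_norm b" for l
    unfolding block21_def T by (rule toeplitz_col_sum_le[OF b]) simp
  have E12: "(\<Sum>\<^sub>\<infinity>l. cmod (?E12 i l)) \<le> e" if "i < k" for i
    using block12_row_sum_le[OF E that] e by linarith
  have E21: "(\<Sum>j<k. cmod (?E21 l j)) \<le> e" for l
    using block21_row_sum_le[OF E] e by (rule order_trans)
  let ?X = "lead k (?T12 *\<^sub>\<infinity> ?E21)" and ?Y = "lead k (?E12 *\<^sub>\<infinity> ?T21)" and ?Z = "lead k (?E12 *\<^sub>\<infinity> ?E21)"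
  have split: "block12 k (T +\<^sub>\<infinity> E) = ?T12 +\<^sub>\<infinity> ?E12" "block21 k (T +\<^sub>\<infinity> E) = ?T21 +\<^sub>\<infinity> ?E21"
    by (simp_all add: block12_def block21_def imat_add_def)
  have expand: "(?T12 +\<^sub>\<infinity> ?E12) *\<^sub>\<infinity> (?T21 +\<^sub>\<infinity> ?E21)
      = (?T12 *\<^sub>\<infinity> ?T21 +\<^sub>\<infinity> ?E12 *\<^sub>\<infinity> ?T21) +\<^sub>\<infinity> (?T12 *\<^sub>\<infinity> ?E21 +\<^sub>\<infinity> ?E12 *\<^sub>\<infinity> ?E21)"
    by (simp add: imat_add_mult_distrib imat_mult_add_distrib bd bounded_linf_op_add)
  have "lead k (?T12 *\<^sub>\<infinity> ?T21) - lead k (block12 k (T +\<^sub>\<infinity> E) *\<^sub>\<infinity> block21 k (T +\<^sub>\<infinity> E))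
      = (- 1) \<cdot>\<^sub>m (?X + ?Y + ?Z)"
    unfolding split expand by (intro eq_matI) (auto simp: imat_add_def)
  then have "mat_norm (lead k (?T12 *\<^sub>\<infinity> ?T21)
      - lead k (block12 k (T +\<^sub>\<infinity> E) *\<^sub>\<infinity> block21 k (T +\<^sub>\<infinity> E))) \<le> mat_norm (?X + ?Y + ?Z)"
    using mat_norm_smult[of "?X + ?Y + ?Z" "- 1"] k by (simp add: lead_def)
  also have "\<dots> \<le> mat_norm (?X + ?Y) + mat_norm ?Z"
    by (rule mat_norm_add_le[where n = k and m = k]) (use k in auto)
  also have "mat_norm (?X + ?Y) \<le> mat_norm ?X + mat_norm ?Y"
    by (rule mat_norm_add_le[where n = k and m = k]) (use k in auto)
  also have "mat_norm ?X \<le> wiener_norm b * e"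
    by (rule mat_norm_lead_mult_le[OF bd(1,4) k T12 E21])
  also have "mat_norm ?Y \<le> e * wiener_norm b"
    by (rule mat_norm_lead_mult_le[OF bd(2,3) k E12 T21])
  also have "mat_norm ?Z \<le> e * e"
    by (rule mat_norm_lead_mult_le[OF bd(2,4) k E12 E21])
  finally show ?thesis by (simp add: algebra_simps)
qed

section \<open>Assembly of the error bound\<close>

theorem mainTheorem5:
  fixes A A1 B E_B T W :: imat
    and b :: "int \<Rightarrow> complex"
    and eps alpha beta :: real
    and k :: nat
    and T11 A11 E11 W11 G :: "complex mat"
  assumes "A = 1\<^sub>\<infinity> -\<^sub>\<infinity> A1" and "A \<in> QT"
    and "imat_nonneg A1" and "imat_norm A1 < 1"
    and "b \<in> wiener" and "E_B \<in> Kd" and "T = toeplitz b" and "B = T +\<^sub>\<infinity> E_B"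
    and "imat_nonneg B" and "imat_norm B < 1"
    and "(1\<^sub>\<infinity> -\<^sub>\<infinity> B) *\<^sub>\<infinity> (1\<^sub>\<infinity> -\<^sub>\<infinity> B) = A"
    and "0 < eps" and "0 < k"
    and "imat_norm (pad (lead k E_B) -\<^sub>\<infinity> E_B) < eps"
    and "W = 2 \<cdot>\<^sub>\<infinity> T -\<^sub>\<infinity> A1 -\<^sub>\<infinity> T *\<^sub>\<infinity> T"
    and "T11 = lead k T" and "W11 = lead k W" and "E11 = lead k E_B" and "A11 = lead k A1"
    and "mat_norm (A11 + lead k (block12 k T *\<^sub>\<infinity> block21 k T)) < 1"
    and "G \<in> carrier_mat k k"
    and "G * G - (1\<^sub>m k - T11) * G - G * (1\<^sub>m k - T11) = W11"
    and "mat_nonneg (T11 + G)" and "spectral_radius (T11 + G) < 1"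
    and "alpha = mat_norm (the (mat_inverse (2 \<cdot>\<^sub>m 1\<^sub>m k - T11 - G)))"
    and "beta = mat_norm (T11 + E11)"
  shows "alpha * beta < 1 \<and>
    imat_norm (pad G -\<^sub>\<infinity> E_B)
      \<le> (1 + alpha / (1 - alpha * beta) * (2 * wiener_norm b + eps)) * eps"
proof -
  note A_def = assms(1) and b = assms(5) and T_def = assms(7) and B_def = assms(8)
    and eps = assms(12) and k = assms(13) and trunc = assms(14) and G = assms(21)
  define S where "S = T11 + G"
  define P where "P = lead k (block12 k T *\<^sub>\<infinity> block21 k T)"
  define Q where "Q = lead k (block12 k B *\<^sub>\<infinity> block21 k B)"
  have Tb: "bounded_linf_op T" unfolding T_def by (rule bounded_linf_op_toeplitz[OF b])
  have Eb: "bounded_linf_op E_B" using assms(6) by (simp add: Kd_def)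
  have Bb: "bounded_linf_op B" unfolding B_def by (rule bounded_linf_op_add[OF Tb Eb])
  have c: "T11 \<in> carrier_mat k k" "E11 \<in> carrier_mat k k" "A11 \<in> carrier_mat k k"
    "P \<in> carrier_mat k k" "Q \<in> carrier_mat k k" "S \<in> carrier_mat k k"
    using G by (simp_all add: assms(16,18,19) P_def Q_def S_def)
  have B11: "T11 + E11 = lead k B"
    unfolding assms(16,18) B_def by (intro eq_matI) (auto simp: lead_def imat_add_def)

  \<comment> \<open>The correction \<open>P\<close> enters because the leading block of the squared
    Toeplitz matrix is \<open>T11 * T11 + P\<close>.\<close>
  have "W11 = 2 \<cdot>\<^sub>m T11 - A11 - lead k (T *\<^sub>\<infinity> T)"
    unfolding assms(15-17,19) by (intro eq_matI) (auto simp: lead_def imat_minus_def imat_smult_def)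
  then have "W11 = 2 \<cdot>\<^sub>m T11 - A11 - (T11 * T11 + P)"
    unfolding lead_mult[OF Tb Tb] P_def assms(16) .
  then have S_eq: "A11 + P = 2 \<cdot>\<^sub>m S - S * S"
    using riccati_imp_sqrt[OF c(1) G c(3,4)] assms(22) unfolding S_def by simp
  have B_eq: "A11 + Q = 2 \<cdot>\<^sub>m (T11 + E11) - (T11 + E11) * (T11 + E11)"
    unfolding B11 Q_def assms(19)
    by (rule lead_sqrt_eq[OF Bb imat_sqrt_eq[OF Bb]]) (use assms(11) A_def in simp)

  \<comment> \<open>By \<open>S_eq\<close> the assumption on \<open>A11 + P\<close> is exactly a
    bound on \<open>2 S - S S\<close>.\<close>
  have S1: "mat_norm S \<le> 1"
    using assms(20,23,24) by (intro mat_norm_sqrt_le_1[OF c(6) k])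
      (auto simp: S_eq[symmetric] S_def[symmetric] P_def)
  have two: "2 \<cdot>\<^sub>m 1\<^sub>m k - T11 - G = 2 \<cdot>\<^sub>m 1\<^sub>m k - S"
    using c(1) G unfolding S_def by (intro eq_matI) auto
  obtain N where N: "N \<in> carrier_mat k k" "alpha = mat_norm N" "N * (2 \<cdot>\<^sub>m 1\<^sub>m k - S) = 1\<^sub>m k"
    using mat_inverse_two_minus[OF c(1) G k assms(24)] assms(25) unfolding two by auto
  have alpha: "0 \<le> alpha" "alpha \<le> 1"
    using mat_norm_nonneg[of N] mat_norm_inverse_two_minus_le_1[OF c(6) N(1) k N(3) S1] N(1,2) k
    by auto
  \<comment> \<open>\<open>T11 + E11\<close> is the leading block of \<open>B\<close>, so its norm
    is at most that of \<open>B\<close>.\<close>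
  have beta: "beta < 1"
    using mat_norm_lead_le[OF Bb k] assms(10,26) unfolding B11 by simp
  have beta0: "0 \<le> beta"
    using mat_norm_nonneg[of "T11 + E11"] assms(26) c k by simp
  have ab: "alpha * beta < 1"
    using alpha beta beta0 mult_left_le_one_le[of beta alpha] by linarith

  define D where "D = S - (T11 + E11)"
  have D: "D \<in> carrier_mat k k" using c unfolding D_def by (intro minus_carrier_mat) simp
  have "(2 \<cdot>\<^sub>m 1\<^sub>m k - S) * D = D * (T11 + E11) + (P - Q)"
    unfolding D_def by (rule sqrt_difference[OF c(6) _ c(3-5) S_eq B_eq]) (use c in simp)
  then have "mat_norm D \<le> alpha / (1 - alpha * beta) * mat_norm (P - Q)"
    unfolding N(2) assms(26)
    by (intro sylvester_norm_bound[OF _ N(1) D _ _ k N(3)])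
      (use c ab in \<open>auto simp: N(2) assms(26)\<close>)
  also have "\<dots> \<le> alpha / (1 - alpha * beta) * ((2 * wiener_norm b + eps) * eps)"
    using block_product_perturbation[OF b T_def Eb k less_imp_le[OF trunc]] alpha ab
    unfolding P_def Q_def B_def by (intro mult_left_mono) auto
  finally have D_le: "mat_norm D \<le> alpha / (1 - alpha * beta) * ((2 * wiener_norm b + eps) * eps)" .

  \<comment> \<open>Since \<open>D = G - E11\<close>, the error separates into the error inside the
    leading block and the truncation error of \<open>E_B\<close>; the latter gives the summand 1 in
    the final factor.\<close>
  have split: "pad G -\<^sub>\<infinity> E_B = pad D +\<^sub>\<infinity> (pad (lead k E_B) -\<^sub>\<infinity> E_B)"
    using c G by (auto simp: fun_eq_iff pad_def imat_minus_def imat_add_def D_def S_def assms(18))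
  have "imat_norm (pad G -\<^sub>\<infinity> E_B) \<le> imat_norm (pad D) + imat_norm (pad (lead k E_B) -\<^sub>\<infinity> E_B)"
    unfolding split by (intro imat_norm_add_le bounded_linf_op_pad bounded_linf_op_minus Eb)
  moreover have "imat_norm (pad D) \<le> mat_norm D"
    by (rule imat_norm_pad_le) (use D k in simp)
  ultimately have "imat_norm (pad G -\<^sub>\<infinity> E_B)
      \<le> alpha / (1 - alpha * beta) * ((2 * wiener_norm b + eps) * eps) + eps"
    using D_le trunc by linarith
  then show ?thesis using ab by (simp add: algebra_simps)
qed

end
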